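(* Let $\mathfrak M$ be a Hilbert space and let $a\in(-1,1)$, $a\neq0$. The fixed points of the mapping $$\mathcal{RS}(\mathfrak M)\ni\Omega(z)\mapsto\Omega\left(\frac{z+a}{1+za}\right)\in\mathcal{RS}(\mathfrak M)$$ consist only of constant functions.
   Context: Hilbert spaces are complex and separable. Let $\mathcal E:=\mathbb C\setminus\{(-\infty,-1]\cup[1,+\infty)\}$. A $\mathbf B(\mathfrak M)$-valued function $M$ is a Nevanlinna function if it is holomorphic outside the real axis, $M(\lambda)^*=M(\bar\lambda)$, and $\operatorname{Im}\lambda\,\operatorname{Im}M(\lambda)\ge0$ for all $\lambda\in\mathbb C\setminus\mathbb R$. The class $\mathcal{RS}(\mathfrak M)$ consists of all $\mathbf B(\mathfrak M)$-valued Nevanlinna functions $\Omega$ which are holomorphic on $\mathcal E$ and satisfy $-I\le\Omega(x)\le I$ for all $x\in(-1,1)$. The Möbius map $z\mapsto\frac{z+a}{1+za}$ maps $\mathcal E$ onto itself. A fixed point is an $\Omega\in\mathcal{RS}(\mathfrak M)$ with $\Omega\left(\frac{z+a}{1+za}\right)=\Omega(z)$ for all $z\in\mathcal E$. *)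

theory Defs
  imports "HOL-Analysis.Analysis"
begin

section \<open>Complex Hilbert spaces\<close>

text \<open>The inner product is linear in the first argument. Multiplication by real scalars is the
  restriction of complex scalar multiplication, so that the topology, norm and completeness of the
  library class \<^class>\<open>banach\<close> apply.\<close>

class complex_hilbert = banach +
  fixes scaleC :: "complex \<Rightarrow> 'a \<Rightarrow> 'a"  (infixr \<open>*\<^sub>C\<close> 75)
    and cinner :: "'a \<Rightarrow> 'a \<Rightarrow> complex"
  assumes scaleC_add_right: "c *\<^sub>C (x + y) = c *\<^sub>C x + c *\<^sub>C y"
    and scaleC_add_left: "(c + d) *\<^sub>C x = c *\<^sub>C x + d *\<^sub>C x"
    and scaleC_scaleC: "c *\<^sub>C (d *\<^sub>C x) = (c * d) *\<^sub>C x"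
    and scaleC_one: "1 *\<^sub>C x = x"
    and scaleR_scaleC: "r *\<^sub>R x = complex_of_real r *\<^sub>C x"
    and cinner_add_left: "cinner (x + y) z = cinner x z + cinner y z"
    and cinner_scaleC_left: "cinner (c *\<^sub>C x) y = c * cinner x y"
    and cinner_commute: "cinner x y = cnj (cinner y x)"
    and cinner_nonneg: "cinner x x \<in> \<real>\<^sub>\<ge>\<^sub>0"
    and cinner_eq_zero_iff: "cinner x x = 0 \<longleftrightarrow> x = 0"
    and norm_eq_sqrt_cinner: "norm x = sqrt (Re (cinner x x))"

instantiation complex :: complex_hilbert
begin
definition scaleC_complex :: "complex \<Rightarrow> complex \<Rightarrow> complex" where "scaleC_complex = (*)"
definition cinner_complex :: "complex \<Rightarrow> complex \<Rightarrow> complex" where "cinner_complex x y = x * cnj y"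
instance
  by standard (auto simp: scaleC_complex_def cinner_complex_def algebra_simps scaleR_conv_of_real
      complex_nonneg_Reals_iff cmod_def power2_eq_square)
end

lemma cinner_self: "cinner x x = complex_of_real ((norm x)\<^sup>2)" for x :: "'a::complex_hilbert"
  using cinner_nonneg[of x] norm_eq_sqrt_cinner[of x]
  by (auto simp: complex_nonneg_Reals_iff complex_eq_iff)

lemma cinner_add_right: "cinner x (y + z) = cinner x y + cinner x z" for x :: "'a::complex_hilbert"
  by (metis cinner_add_left cinner_commute complex_cnj_add)

lemma cinner_scaleC_right: "cinner x (c *\<^sub>C y) = cnj c * cinner x y" for x :: "'a::complex_hilbert"
  by (metis cinner_scaleC_left cinner_commute complex_cnj_mult)

lemma cinner_scaleR_left: "cinner (r *\<^sub>R x) y = r * cinner x y" for x :: "'a::complex_hilbert"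
  by (simp add: scaleR_scaleC cinner_scaleC_left)

lemma cinner_scaleR_right: "cinner x (r *\<^sub>R y) = r * cinner x y" for x :: "'a::complex_hilbert"
  by (simp add: scaleR_scaleC cinner_scaleC_right)

lemma cinner_minus_left: "cinner (- x) y = - cinner x y" for x :: "'a::complex_hilbert"
  using cinner_scaleR_left[of "-1" x y] by simp

lemma cinner_minus_right: "cinner x (- y) = - cinner x y" for x :: "'a::complex_hilbert"
  using cinner_scaleR_right[of x "-1" y] by simp

lemma cinner_diff_left: "cinner (x - y) z = cinner x z - cinner y z" for x :: "'a::complex_hilbert"
  using cinner_add_left[of x "- y" z] by (simp add: cinner_minus_left)

lemma cinner_diff_right: "cinner x (y - z) = cinner x y - cinner x z" for x :: "'a::complex_hilbert"
  using cinner_add_right[of x y "- z"] by (simp add: cinner_minus_right)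

lemma cinner_zero_left [simp]: "cinner 0 y = 0" for y :: "'a::complex_hilbert"
  using cinner_scaleR_left[of 0 0 y] by simp

lemma cinner_zero_right [simp]: "cinner x 0 = 0" for x :: "'a::complex_hilbert"
  using cinner_scaleR_right[of x 0 0] by simp

lemmas cinner_simps = cinner_add_left cinner_add_right cinner_diff_left cinner_diff_right
  cinner_scaleC_left cinner_scaleC_right cinner_scaleR_left cinner_scaleR_right

lemma norm_scaleC: "norm (c *\<^sub>C x) = cmod c * norm x" for x :: "'a::complex_hilbert"
proof -
  have "complex_of_real ((norm (c *\<^sub>C x))\<^sup>2) = (c * cnj c) * complex_of_real ((norm x)\<^sup>2)"
    by (simp only: cinner_self[symmetric] cinner_simps mult.assoc mult.left_commute)
  also have "\<dots> = complex_of_real ((cmod c * norm x)\<^sup>2)"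
    by (simp add: complex_norm_square[symmetric] power_mult_distrib)
  finally have "(norm (c *\<^sub>C x))\<^sup>2 = (cmod c * norm x)\<^sup>2"
    by (simp only: of_real_eq_iff)
  then show ?thesis
    by (simp add: power2_eq_iff_nonneg)
qed

lemma norm_add_sq: "(norm (x + y))\<^sup>2 = (norm x)\<^sup>2 + (norm y)\<^sup>2 + 2 * Re (cinner x y)"
  for x :: "'a::complex_hilbert"
proof -
  have "(norm (x + y))\<^sup>2 = Re (cinner (x + y) (x + y))"
    by (simp only: cinner_self Re_complex_of_real)
  also have "\<dots> = (norm x)\<^sup>2 + (norm y)\<^sup>2 + Re (cinner x y) + Re (cinner y x)"
    unfolding cinner_add_left cinner_add_right by (simp add: cinner_self)
  also have "Re (cinner y x) = Re (cinner x y)"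
    by (subst cinner_commute) simp
  finally show ?thesis by simp
qed

lemma cinner_Cauchy_Schwarz: "cmod (cinner x y) \<le> norm x * norm y" for x :: "'a::complex_hilbert"
proof (cases "y = 0")
  case False
  define c where "c = cinner x y / complex_of_real ((norm y)\<^sup>2)"
  have ny: "norm y > 0" using False by simp
  have "0 \<le> (norm (x + (- c) *\<^sub>C y))\<^sup>2" by simp
  also have "\<dots> = (norm x)\<^sup>2 + (cmod c * norm y)\<^sup>2 - 2 * Re (cnj c * cinner x y)"
    by (simp add: norm_add_sq norm_scaleC cinner_scaleC_right)
  also have "cnj c * cinner x y = complex_of_real ((cmod (cinner x y))\<^sup>2 / (norm y)\<^sup>2)"
    using complex_norm_square[of "cinner x y"] by (simp add: c_def mult.commute)
  also have "(cmod c * norm y)\<^sup>2 = (cmod (cinner x y))\<^sup>2 / (norm y)\<^sup>2"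
    using ny by (simp add: c_def norm_divide norm_mult power2_eq_square field_simps)
  finally have "(cmod (cinner x y))\<^sup>2 / (norm y)\<^sup>2 \<le> (norm x)\<^sup>2"
    by simp
  then have "(cmod (cinner x y))\<^sup>2 \<le> (norm x * norm y)\<^sup>2"
    using ny by (simp add: divide_le_eq power_mult_distrib)
  then show ?thesis
    by (rule power2_le_imp_le) simp
qed simp

lemma cinner_ext: "(\<And>x. cinner x u = cinner x v) \<Longrightarrow> u = v" for u :: "'a::complex_hilbert"
  using cinner_eq_zero_iff[of "u - v"] by (simp add: cinner_diff_right)

theorem Riesz_representation:
  fixes f :: "'a::complex_hilbert \<Rightarrow> complex"
  assumes bl: "bounded_linear f" and hom: "\<And>c x. f (c *\<^sub>C x) = c * f x"
  shows "\<exists>v. \<forall>x. f x = cinner x v"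
proof (cases "\<forall>x. f x = 0")
  case True
  then show ?thesis by (intro exI[of _ 0]) simp
next
  case False
  interpret bounded_linear f by (rule bl)
  obtain w where w: "f w \<noteq> 0" using False by blast
  define S where "S = {x. f x = 1}"
  define d where "d = (INF x\<in>S. norm x)"
  have ne: "S \<noteq> {}"
    using w hom[of "1 / f w" w] by (auto simp: S_def intro!: exI[of _ "(1 / f w) *\<^sub>C w"])
  have bdd: "bdd_below (norm ` S)" by (rule bdd_belowI[of _ 0]) auto
  have d_le: "d \<le> norm x" if "x \<in> S" for x
    unfolding d_def using bdd that by (rule cINF_lower)
  have d0: "d \<ge> 0" unfolding d_def using ne by (intro cINF_greatest) auto
  have "\<exists>x\<in>S. norm x < d + inverse (real (Suc n))" for n
  proof (rule ccontr)
    assume "\<not> ?thesis"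
    then have "d + inverse (real (Suc n)) \<le> d"
      unfolding d_def[of] using ne by (intro cINF_greatest) (auto simp: not_less d_def)
    then show False by (simp del: of_nat_Suc)
  qed
  then obtain s where s: "\<And>n. s n \<in> S" "\<And>n. norm (s n) < d + inverse (real (Suc n))"
    by metis
  have nlim: "(\<lambda>n. norm (s n)) \<longlonglongrightarrow> d"
  proof (rule real_tendsto_sandwich[of "\<lambda>n. d" _ _ "\<lambda>n. d + inverse (real (Suc n))"])
    show "(\<lambda>n. d + inverse (real (Suc n))) \<longlonglongrightarrow> d"
      using tendsto_add[OF tendsto_const LIMSEQ_inverse_real_of_nat] by simp
  qed (auto intro!: always_eventually d_le s(1) less_imp_le[OF s(2)] simp del: of_nat_Suc)
  have par: "(norm (x - y))\<^sup>2 \<le> 2 * (norm x)\<^sup>2 + 2 * (norm y)\<^sup>2 - 4 * d\<^sup>2"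
    if "x \<in> S" "y \<in> S" for x y
  proof -
    have "(1/2) *\<^sub>R (x + y) \<in> S"
      using that by (simp add: S_def scaleR add scaleR_conv_of_real)
    then have "d \<le> norm ((1/2) *\<^sub>R (x + y))" by (rule d_le)
    then have "2 * d \<le> norm (x + y)" by simp
    then have "(2 * d)\<^sup>2 \<le> (norm (x + y))\<^sup>2" using d0 by (intro power_mono) auto
    moreover have "(norm (x - y))\<^sup>2 = (norm x)\<^sup>2 + (norm y)\<^sup>2 - 2 * Re (cinner x y)"
      using norm_add_sq[of x "- y"] by (simp add: cinner_minus_right)
    ultimately show ?thesis using norm_add_sq[of x y] by (simp add: power_mult_distrib)
  qed
  have "Cauchy s"
  proof (rule metric_CauchyI)
    fix e :: real assume e: "e > 0"
    have "(\<lambda>n. (norm (s n))\<^sup>2) \<longlonglongrightarrow> d\<^sup>2" by (intro tendsto_intros nlim)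
    moreover have "d\<^sup>2 < d\<^sup>2 + e\<^sup>2 / 4" using e by simp
    ultimately have "\<forall>\<^sub>F n in sequentially. (norm (s n))\<^sup>2 < d\<^sup>2 + e\<^sup>2 / 4"
      by (rule order_tendstoD)
    then obtain N where N: "\<And>n. n \<ge> N \<Longrightarrow> (norm (s n))\<^sup>2 < d\<^sup>2 + e\<^sup>2 / 4"
      by (auto simp: eventually_sequentially)
    have "dist (s m) (s n) < e" if "m \<ge> N" "n \<ge> N" for m n
    proof -
      have "(norm (s m - s n))\<^sup>2 < e\<^sup>2"
        using par[OF s(1)[of m] s(1)[of n]] N[OF that(1)] N[OF that(2)] by (simp add: field_simps)
      then show ?thesis using e by (simp add: dist_norm power2_less_imp_less)
    qed
    then show "\<exists>M. \<forall>m\<ge>M. \<forall>n\<ge>M. dist (s m) (s n) < e" by blast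
  qed
  then obtain u where u: "s \<longlonglongrightarrow> u" using Cauchy_convergent convergent_def by blast
  have "(\<lambda>n. f (s n)) \<longlonglongrightarrow> f u" by (rule tendsto[OF u])
  moreover have "(\<lambda>n. f (s n)) = (\<lambda>n. 1)" using s(1) by (simp add: S_def)
  ultimately have fu: "f u = 1" using LIMSEQ_unique[OF tendsto_const[of 1]] by auto
  have nu: "norm u = d" using LIMSEQ_unique[OF tendsto_norm[OF u] nlim] .
  have u0: "u \<noteq> 0" using fu zero by auto
  have orth: "cinner y u = 0" if y: "f y = 0" for y
  proof (cases "y = 0")
    case False
    define c where "c = - cinner u y / complex_of_real ((norm y)\<^sup>2)"
    have ny: "norm y > 0" using False by simp
    have "u + c *\<^sub>C y \<in> S" by (simp add: S_def add hom y fu)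
    then have "d\<^sup>2 \<le> (norm (u + c *\<^sub>C y))\<^sup>2" using d_le d0 by (intro power_mono) auto
    also have "\<dots> = d\<^sup>2 + (cmod c * norm y)\<^sup>2 + 2 * Re (cnj c * cinner u y)"
      by (simp add: norm_add_sq norm_scaleC cinner_scaleC_right nu)
    also have "cnj c * cinner u y = - complex_of_real ((cmod (cinner u y))\<^sup>2 / (norm y)\<^sup>2)"
      using complex_norm_square[of "cinner u y"] by (simp add: c_def mult.commute)
    also have "(cmod c * norm y)\<^sup>2 = (cmod (cinner u y))\<^sup>2 / (norm y)\<^sup>2"
      using ny by (simp add: c_def norm_divide norm_mult power2_eq_square field_simps)
    finally have "(cmod (cinner u y))\<^sup>2 / (norm y)\<^sup>2 \<le> 0" by simp
    then have "cinner u y = 0" using ny by (simp add: divide_le_0_iff)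
    then show ?thesis by (subst cinner_commute) simp
  qed simp
  have "f x = cinner x ((1 / (norm u)\<^sup>2) *\<^sub>R u)" for x
  proof -
    have "cinner (x - f x *\<^sub>C u) u = 0" by (rule orth) (simp add: diff hom fu)
    then have "cinner x u = f x * complex_of_real ((norm u)\<^sup>2)"
      by (simp add: cinner_diff_left cinner_scaleC_left cinner_self)
    then show ?thesis using u0 by (simp add: cinner_scaleR_right)
  qed
  then show ?thesis by blast
qed

section \<open>The algebra \<open>B(M)\<close>\<close>

text \<open>Elements of the library type \<open>'a \<Rightarrow>\<^sub>L 'a\<close> are the bounded real-linear operators with the operator
  norm; \<open>B(M)\<close> is the set of those that are complex-linear.\<close>

definition bounded_ops :: "('a::complex_hilbert \<Rightarrow>\<^sub>L 'a) set"
  where "bounded_ops = {T :: 'a \<Rightarrow>\<^sub>L 'a. \<forall>c x. T (c *\<^sub>C x) = c *\<^sub>C T x}"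

lift_definition scaleC_op :: "complex \<Rightarrow> ('a \<Rightarrow>\<^sub>L 'a) \<Rightarrow> 'a::complex_hilbert \<Rightarrow>\<^sub>L 'a"
  is "\<lambda>c T x. c *\<^sub>C T x"
proof -
  fix c :: complex and T :: "'a \<Rightarrow> 'a" assume T: "bounded_linear T"
  have "bounded_linear (\<lambda>x::'a. c *\<^sub>C x)"
    by (rule bounded_linear_intro[where K = "cmod c"])
      (auto simp: scaleC_add_right scaleR_scaleC scaleC_scaleC norm_scaleC mult.commute)
  from bounded_linear_compose[OF this T] show "bounded_linear (\<lambda>x. c *\<^sub>C T x)" .
qed

lemma bounded_bilinear_scaleC_op:
  "bounded_bilinear (scaleC_op :: complex \<Rightarrow> ('a \<Rightarrow>\<^sub>L 'a) \<Rightarrow> 'a::complex_hilbert \<Rightarrow>\<^sub>L 'a)"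
proof
  show "\<exists>K. \<forall>c (T :: 'a \<Rightarrow>\<^sub>L 'a). norm (scaleC_op c T) \<le> norm c * norm T * K"
  proof (intro exI[of _ 1] allI norm_blinfun_bound)
    fix c and T :: "'a \<Rightarrow>\<^sub>L 'a" and x
    show "norm (scaleC_op c T x) \<le> norm c * norm T * 1 * norm x"
      using norm_blinfun[of T x] by (simp add: scaleC_op.rep_eq norm_scaleC mult_left_mono mult.assoc)
  qed simp
qed (auto intro!: blinfun_eqI simp: scaleC_op.rep_eq blinfun.add_left blinfun.scaleR_left
    scaleC_add_left scaleC_add_right scaleR_scaleC[where 'a = 'a] scaleC_scaleC
    scaleR_conv_of_real[where 'a = complex] mult.commute[of _ "complex_of_real _"])

lemma scaleC_op_scaleC_op: "scaleC_op c (scaleC_op d T) = scaleC_op (c * d) T"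
  by (rule blinfun_eqI) (simp add: scaleC_op.rep_eq scaleC_scaleC)

definition cadjoint :: "('a::complex_hilbert \<Rightarrow>\<^sub>L 'a) \<Rightarrow> ('a \<Rightarrow>\<^sub>L 'a)"
  where "cadjoint T = (THE S :: 'a \<Rightarrow>\<^sub>L 'a. \<forall>x y. cinner (T x) y = cinner x (S y))"

theorem ex1_cadjoint:
  fixes T :: "'a::complex_hilbert \<Rightarrow>\<^sub>L 'a"
  assumes T: "T \<in> bounded_ops"
  shows "\<exists>!S :: 'a \<Rightarrow>\<^sub>L 'a. \<forall>x y. cinner (T x) y = cinner x (S y)"
proof -
  have "\<exists>v. \<forall>x. cinner (T x) y = cinner x v" for y
  proof (rule Riesz_representation)
    have "cmod (cinner (T x) y) \<le> norm x * (norm T * norm y)" for x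
    proof -
      have "cmod (cinner (T x) y) \<le> norm (T x) * norm y" by (rule cinner_Cauchy_Schwarz)
      also have "\<dots> \<le> (norm T * norm x) * norm y"
        by (intro mult_right_mono norm_blinfun) auto
      finally show ?thesis by (simp add: mult_ac)
    qed
    then show "bounded_linear (\<lambda>x. cinner (T x) y)"
      by (intro bounded_linear_intro[where K = "norm T * norm y"])
        (auto simp: blinfun.add_right blinfun.scaleR_right cinner_simps scaleR_conv_of_real)
    show "cinner (T (c *\<^sub>C x)) y = c * cinner (T x) y" for c x
      using T by (simp add: bounded_ops_def cinner_scaleC_left)
  qed
  then obtain g where g: "\<And>x y. cinner (T x) y = cinner x (g y)" by metis
  have "bounded_linear g"
  proof (rule bounded_linear_intro[where K = "norm T"])
    show "g (x + y) = g x + g y" for x y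
      by (rule cinner_ext) (simp add: cinner_add_right g[symmetric])
    show "g (r *\<^sub>R x) = r *\<^sub>R g x" for r x
      by (rule cinner_ext) (simp add: cinner_scaleR_right g[symmetric])
    show "norm (g y) \<le> norm y * norm T" for y
    proof (cases "g y = 0")
      case False
      have "(norm (g y))\<^sup>2 = cmod (cinner (T (g y)) y)"
        by (simp add: g cinner_self norm_power)
      also have "\<dots> \<le> norm (T (g y)) * norm y" by (rule cinner_Cauchy_Schwarz)
      also have "\<dots> \<le> (norm T * norm (g y)) * norm y"
        by (intro mult_right_mono norm_blinfun) auto
      finally show ?thesis using False by (simp add: power2_eq_square mult_ac)
    qed simp
  qed
  then have S: "blinfun_apply (Blinfun g) = g" by (rule bounded_linear_Blinfun_apply)
  show ?thesis
  proof (rule ex1I[of _ "Blinfun g"])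
    show "\<forall>x y. cinner (T x) y = cinner x (Blinfun g y)" unfolding S using g by blast
    fix R :: "'a \<Rightarrow>\<^sub>L 'a" assume R: "\<forall>x y. cinner (T x) y = cinner x (R y)"
    have "R y = g y" for y
      by (rule cinner_ext) (metis R g)
    then show "R = Blinfun g"
      by (intro blinfun_eqI) (simp only: S)
  qed
qed

lemma cadjoint: "T \<in> bounded_ops \<Longrightarrow> cinner (T x) y = cinner x (cadjoint T y)"
  using theI'[OF ex1_cadjoint] unfolding cadjoint_def by blast

definition Im_op :: "('a::complex_hilbert \<Rightarrow>\<^sub>L 'a) \<Rightarrow> ('a \<Rightarrow>\<^sub>L 'a)"
  where "Im_op T = scaleC_op (1 / (2 * \<i>)) (T - cadjoint T)"

text \<open>The usual (Loewner) order of operators; on a complex space, a nonnegative quadratic form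
  makes the difference self-adjoint.\<close>

definition op_le :: "('a::complex_hilbert \<Rightarrow>\<^sub>L 'a) \<Rightarrow> ('a \<Rightarrow>\<^sub>L 'a) \<Rightarrow> bool"  (infix \<open>\<le>\<^sub>o\<^sub>p\<close> 50)
  where "A \<le>\<^sub>o\<^sub>p B \<longleftrightarrow> (\<forall>x. cinner ((B - A) x) x \<in> \<real>\<^sub>\<ge>\<^sub>0)"

text \<open>Complex differentiability in operator norm.\<close>

definition op_holomorphic_on ::
    "(complex \<Rightarrow> 'a::complex_hilbert \<Rightarrow>\<^sub>L 'a) \<Rightarrow> complex set \<Rightarrow> bool"
    (infixl \<open>op'_holomorphic'_on\<close> 50)
  where "F op_holomorphic_on S \<longleftrightarrow>
    (\<forall>z\<in>S. \<exists>D. ((\<lambda>w. scaleC_op (1 / (w - z)) (F w - F z)) \<longlongrightarrow> D) (at z within S))"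

section \<open>The class \<open>RS(M)\<close>\<close>

text \<open>Functions are total in HOL: only the values off the real axis matter for
  \<open>nevanlinna\<close>, and only those on \<open>\<E>\<close> for \<open>RS\<close>.\<close>

definition slit_domain :: "complex set"  (\<open>\<E>\<close>)
  where "\<E> = - complex_of_real ` ({..-1} \<union> {1..})"

definition nevanlinna :: "(complex \<Rightarrow> 'a::complex_hilbert \<Rightarrow>\<^sub>L 'a) \<Rightarrow> bool"
  where "nevanlinna M \<longleftrightarrow>
    (\<forall>z\<in>- \<real>. M z \<in> bounded_ops) \<and>
    M op_holomorphic_on (- \<real>) \<and>
    (\<forall>z\<in>- \<real>. cadjoint (M z) = M (cnj z)) \<and>
    (\<forall>z\<in>- \<real>. 0 \<le>\<^sub>o\<^sub>p Im z *\<^sub>R Im_op (M z))"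

definition RS :: "(complex \<Rightarrow> 'a::complex_hilbert \<Rightarrow>\<^sub>L 'a) set"
  where "RS = {\<Omega>. nevanlinna \<Omega> \<and>
    (\<forall>z\<in>\<E>. \<Omega> z \<in> bounded_ops) \<and>
    \<Omega> op_holomorphic_on \<E> \<and>
    (\<forall>x\<in>{-1<..<1::real}. - id_blinfun \<le>\<^sub>o\<^sub>p \<Omega> (of_real x) \<and> \<Omega> (of_real x) \<le>\<^sub>o\<^sub>p id_blinfun)}"

definition moebius :: "real \<Rightarrow> complex \<Rightarrow> complex"
  where "moebius a z = (z + of_real a) / (1 + z * of_real a)"

definition moebius_map :: "real \<Rightarrow> (complex \<Rightarrow> 'b) \<Rightarrow> complex \<Rightarrow> 'b"
  where "moebius_map a \<Omega> = (\<lambda>z. \<Omega> (moebius a z))"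

lemma mem_slit_domain_iff: "z \<in> \<E> \<longleftrightarrow> Im z \<noteq> 0 \<or> \<bar>Re z\<bar> < 1"
  by (force simp: slit_domain_def image_iff complex_eq_iff)

lemma open_slit_domain: "open \<E>"
  unfolding slit_domain_def image_Un
  by (intro open_Compl closed_Un closed_slot_left closed_slot_right)

context
  fixes a :: real
  assumes a: "a \<in> {-1<..<1}"
begin

lemma moebius_denom_nz: "z \<in> \<E> \<Longrightarrow> 1 + z * of_real a \<noteq> 0"
proof
  assume z: "z \<in> \<E>" and eq: "1 + z * of_real a = 0"
  then have "1 + Re z * a = 0" "Im z * a = 0"
    by (simp_all add: complex_eq_iff)
  moreover from this have "a \<noteq> 0" by auto
  ultimately have "\<bar>Re z\<bar> < 1" "Re z * a = -1"
    using z by (auto simp: mem_slit_domain_iff)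
  then have "\<bar>Re z\<bar> * \<bar>a\<bar> = 1" by (simp add: abs_mult[symmetric])
  moreover have "\<bar>Re z\<bar> * \<bar>a\<bar> < 1 * 1"
    using \<open>\<bar>Re z\<bar> < 1\<close> a by (intro mult_strict_mono') auto
  ultimately show False by simp
qed

lemma moebius_real: "x \<in> {-1<..<1} \<Longrightarrow> moebius a (of_real x) \<in> of_real ` {-1<..<1}"
proof -
  assume x: "x \<in> {-1<..<1}"
  have "\<bar>x * a\<bar> < 1 * 1" unfolding abs_mult using x a by (intro mult_strict_mono') auto
  then have pos: "1 + x * a > 0" by auto
  have "(1 - x) * (1 - a) > 0" "(1 + x) * (1 + a) > 0"
    using x a by (auto intro!: mult_pos_pos)
  then have "(x + a) / (1 + x * a) \<in> {-1<..<1}"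
    using pos by (auto simp: field_simps)
  moreover have "moebius a (of_real x) = of_real ((x + a) / (1 + x * a))"
    by (simp add: moebius_def)
  ultimately show ?thesis by blast
qed

lemma Im_moebius:
  "Im (moebius a z) = Im z * (1 - a\<^sup>2) / (cmod (1 + z * of_real a))\<^sup>2"
proof -
  have "moebius a z = (z + of_real a) * cnj (1 + z * of_real a) / (cmod (1 + z * of_real a))\<^sup>2"
    unfolding moebius_def by (rule complex_div_cnj)
  then show ?thesis
    by (simp add: power2_eq_square algebra_simps diff_divide_distrib add_divide_distrib
        flip: of_real_power)
qed

lemma Im_moebius_pos: "z \<in> - \<real> \<Longrightarrow> \<exists>r>0. Im (moebius a z) = r * Im z"
proof -
  assume "z \<in> - \<real>"
  then have z: "z \<in> \<E>" by (auto simp: mem_slit_domain_iff complex_is_Real_iff)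
  have "a\<^sup>2 < 1" using a by (simp add: abs_square_less_1 abs_less_iff)
  then show ?thesis
    using moebius_denom_nz[OF z]
    by (intro exI[of _ "(1 - a\<^sup>2) / (cmod (1 + z * of_real a))\<^sup>2"]) (simp add: Im_moebius)
qed

lemma moebius_nonreal: "z \<in> - \<real> \<Longrightarrow> moebius a z \<in> - \<real>"
  using Im_moebius_pos[of z] by (auto simp: complex_is_Real_iff)

lemma moebius_slit_domain: "z \<in> \<E> \<Longrightarrow> moebius a z \<in> \<E>"
proof (cases "Im z = 0")
  case True
  assume "z \<in> \<E>"
  with True have "z = of_real (Re z)" "Re z \<in> {-1<..<1}"
    by (auto simp: mem_slit_domain_iff complex_eq_iff)
  then show ?thesis
    using moebius_real[of "Re z"] by (auto simp: mem_slit_domain_iff)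
next
  case False
  then show ?thesis
    using moebius_nonreal[of z] by (auto simp: mem_slit_domain_iff complex_is_Real_iff)
qed

lemma moebius_cnj: "moebius a (cnj z) = cnj (moebius a z)"
  by (simp add: moebius_def)

lemma moebius_has_field_derivative:
  assumes "z \<in> \<E>"
  shows "(moebius a has_field_derivative (1 - (of_real a)\<^sup>2) / (1 + z * of_real a)\<^sup>2) (at z)"
  unfolding moebius_def[abs_def] using moebius_denom_nz[OF assms]
  by (auto intro!: derivative_eq_intros simp: power2_eq_square algebra_simps)

lemma moebius_inj: "inj_on (moebius a) \<E>"
proof (rule inj_onI)
  fix z w assume zw: "z \<in> \<E>" "w \<in> \<E>" "moebius a z = moebius a w"
  then have "(z + of_real a) * (1 + w * of_real a) = (w + of_real a) * (1 + z * of_real a)"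
    using moebius_denom_nz by (simp add: moebius_def frac_eq_eq)
  then have "(z - w) * of_real (1 - a\<^sup>2) = 0"
    by (simp add: power2_eq_square algebra_simps)
  moreover have "a\<^sup>2 < 1" using a by (simp add: abs_square_less_1 abs_less_iff)
  ultimately show "z = w" by (simp del: of_real_diff of_real_power)
qed

lemma moebius_map_op_holomorphic:
  fixes F :: "complex \<Rightarrow> 'a::complex_hilbert \<Rightarrow>\<^sub>L 'a"
  assumes S: "open S" "S \<subseteq> \<E>" "moebius a ` S \<subseteq> S" and F: "F op_holomorphic_on S"
  shows "moebius_map a F op_holomorphic_on S"
  unfolding op_holomorphic_on_def
proof
  fix z assume z: "z \<in> S"
  let ?m = "moebius a"
  from z S have zE: "z \<in> \<E>" and mz: "?m z \<in> S" by auto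
  obtain D where "((\<lambda>w. scaleC_op (1 / (w - ?m z)) (F w - F (?m z))) \<longlongrightarrow> D) (at (?m z) within S)"
    using F mz unfolding op_holomorphic_on_def by blast
  then have D: "((\<lambda>w. scaleC_op (1 / (w - ?m z)) (F w - F (?m z))) \<longlongrightarrow> D) (at (?m z))"
    by (simp only: at_within_open[OF mz S(1)])
  obtain d where d: "(?m has_field_derivative d) (at z)"
    using moebius_has_field_derivative[OF zE] by blast
  have nz: "\<forall>\<^sub>F w in at z. w \<in> S \<and> w \<noteq> z"
    using eventually_at_in_open[OF S(1) z] by (simp add: Diff_iff)
  have ne: "\<forall>\<^sub>F w in at z. ?m w \<noteq> ?m z"
    using nz by eventually_elim (use inj_onD[OF moebius_inj] S(2) zE in blast)
  have "filterlim ?m (at (?m z)) (at z)"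
    unfolding filterlim_at using ne DERIV_isCont[OF d] by (auto simp: isCont_def)
  from filterlim_compose[OF D this]
  have 1: "((\<lambda>w. scaleC_op (1 / (?m w - ?m z)) (F (?m w) - F (?m z))) \<longlongrightarrow> D) (at z)" .
  have 2: "((\<lambda>w. (?m w - ?m z) / (w - z)) \<longlongrightarrow> d) (at z)"
    using d by (simp add: has_field_derivative_iff)
  have "((\<lambda>w. scaleC_op ((?m w - ?m z) / (w - z)) (scaleC_op (1 / (?m w - ?m z)) (F (?m w) - F (?m z))))
      \<longlongrightarrow> scaleC_op d D) (at z)"
    by (rule bounded_bilinear.tendsto[OF bounded_bilinear_scaleC_op 2 1])
  then have "((\<lambda>w. scaleC_op (1 / (w - z)) (F (?m w) - F (?m z))) \<longlongrightarrow> scaleC_op d D) (at z)"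
  proof (rule Lim_transform_eventually)
    show "\<forall>\<^sub>F w in at z. scaleC_op ((?m w - ?m z) / (w - z))
        (scaleC_op (1 / (?m w - ?m z)) (F (?m w) - F (?m z))) =
        scaleC_op (1 / (w - z)) (F (?m w) - F (?m z))"
      using ne by eventually_elim (simp add: scaleC_op_scaleC_op)
  qed
  then show "\<exists>D. ((\<lambda>w. scaleC_op (1 / (w - z)) (moebius_map a F w - moebius_map a F z)) \<longlongrightarrow> D)
      (at z within S)"
    unfolding moebius_map_def at_within_open[OF z S(1)] by blast
qed

theorem moebius_map_RS:
  fixes \<Omega> :: "complex \<Rightarrow> 'a::complex_hilbert \<Rightarrow>\<^sub>L 'a"
  assumes "\<Omega> \<in> RS"
  shows "moebius_map a \<Omega> \<in> RS"
proof -
  have nev: "nevanlinna \<Omega>" and E: "\<forall>z\<in>\<E>. \<Omega> z \<in> bounded_ops" and hol: "\<Omega> op_holomorphic_on \<E>"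
    and le: "\<forall>x\<in>{-1<..<1::real}. - id_blinfun \<le>\<^sub>o\<^sub>p \<Omega> (of_real x) \<and> \<Omega> (of_real x) \<le>\<^sub>o\<^sub>p id_blinfun"
    using assms by (auto simp: RS_def)
  have sub: "- \<real> \<subseteq> \<E>" by (auto simp: mem_slit_domain_iff complex_is_Real_iff)
  have "0 \<le>\<^sub>o\<^sub>p Im z *\<^sub>R Im_op (\<Omega> (moebius a z))" if z: "z \<in> - \<real>" for z
  proof -
    obtain r where r: "r > 0" "Im (moebius a z) = r * Im z" using Im_moebius_pos[OF z] by blast
    have "0 \<le>\<^sub>o\<^sub>p Im (moebius a z) *\<^sub>R Im_op (\<Omega> (moebius a z))"
      using nev moebius_nonreal[OF z] by (auto simp: nevanlinna_def)
    then show ?thesis using r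
      by (auto simp: op_le_def blinfun.scaleR_left cinner_scaleR_left complex_nonneg_Reals_iff
          zero_le_mult_iff mult.assoc)
  qed
  then have "nevanlinna (moebius_map a \<Omega>)"
    using nev moebius_nonreal moebius_map_op_holomorphic[of "- \<real>" \<Omega>] sub
    by (auto simp: nevanlinna_def moebius_map_def moebius_cnj open_Compl closed_complex_Reals)
  moreover have "moebius_map a \<Omega> op_holomorphic_on \<E>"
    using moebius_slit_domain by (intro moebius_map_op_holomorphic open_slit_domain hol) auto
  moreover have "\<forall>z\<in>\<E>. moebius_map a \<Omega> z \<in> bounded_ops"
    using E moebius_slit_domain by (simp add: moebius_map_def)
  moreover have "- id_blinfun \<le>\<^sub>o\<^sub>p moebius_map a \<Omega> (of_real x) \<and> moebius_map a \<Omega> (of_real x) \<le>\<^sub>o\<^sub>p id_blinfun"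
    if "x \<in> {-1<..<1}" for x
    using moebius_real[OF that] le by (auto simp: moebius_map_def)
  ultimately show ?thesis by (auto simp: RS_def)
qed

end

definition moebius_fixed_points :: "real \<Rightarrow> (complex \<Rightarrow> 'a::complex_hilbert \<Rightarrow>\<^sub>L 'a) set"
  where "moebius_fixed_points a = {\<Omega> \<in> RS. \<forall>z\<in>\<E>. moebius_map a \<Omega> z = \<Omega> z}"

end

theory Submission
  imports Defs "HOL-Complex_Analysis.Complex_Analysis"
begin

text \<open>Each quadratic form \<open>f(z) = \<langle>\<Omega>(z)x, x\<rangle>\<close> is a scalar Nevanlinna function that is real on
  \<open>(-1, 1)\<close>, hence nondecreasing there: \<open>f' = \<partial>(Im f)/\<partial>y \<ge> 0\<close> on the interval. For a fixed point,
  \<open>f(0) = f(a)\<close>, so \<open>f\<close> is constant between \<open>0\<close> and \<open>a\<close>, and on \<open>\<E>\<close> by the identity theorem.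
  Polarization recovers \<open>\<Omega>\<close> from its quadratic forms.\<close>

text \<open>Differentiating along the vertical line through \<open>t\<close> multiplies
  \<open>f'\<close> by \<i>, and \<open>Im (\<i> * f') = Re f'\<close>. So \<open>Re f'\<close> is a
  limit of difference quotients of \<open>Im f\<close>, whose sign \<open>nonneg\<close> controls on
  both sides of the real axis.\<close>

lemma nevanlinna_deriv_nonneg:
  assumes f': "(f has_field_derivative f') (at (of_real t))"
    and real: "Im (f (of_real t)) = 0"
    and nonneg: "\<And>z. Im z \<noteq> 0 \<Longrightarrow> 0 \<le> Im z * Im (f z)"
  shows "0 \<le> Re f'"
proof -
  define g where "g = (\<lambda>y. Im (f (Complex t y)))"
  have "((\<lambda>y::real. Complex t y) has_vector_derivative \<i>) (at 0)"
    by (auto simp: has_vector_derivative_def Complex_eq scaleR_conv_of_real mult.commute[of \<i>] intro!: derivative_eq_intros)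
  then have "((f \<circ> (\<lambda>y. Complex t y)) has_vector_derivative (\<i> * f')) (at 0)"
    using f' by (intro field_vector_diff_chain_at) (auto simp: complex_of_real_def)
  then have "(g has_real_derivative Re f') (at 0)"
    using bounded_linear.has_vector_derivative[OF bounded_linear_Im]
    by (fastforce simp: g_def o_def has_real_derivative_iff_has_vector_derivative)
  then have lim: "((\<lambda>h. g h / h) \<longlongrightarrow> Re f') (at 0)"
    using real by (simp add: has_field_derivative_iff g_def complex_of_real_def)
  \<comment> \<open>At \<open>Complex t h\<close> the sign condition reads
    \<open>0 \<le> h * g h\<close>, and \<open>g h / h\<close> has the same sign as this
    product.\<close>
  have "0 \<le> g h / h" if "h \<noteq> 0" for h
    using nonneg[of "Complex t h"] that
    by (simp add: g_def zero_le_mult_iff zero_le_divide_iff) linarith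
  then show ?thesis
    by (intro tendsto_lowerbound[OF lim]) (auto simp: eventually_at_filter)
qed

text \<open>\<open>g t\<close> is squeezed between the equal values \<open>g 0\<close> and
  \<open>g a\<close>; the four instances of \<open>mono\<close> cover both signs of
  \<open>a\<close>.\<close>

lemma nondecreasing_eq_between:
  fixes g :: "real \<Rightarrow> real"
  assumes "a \<in> {-1<..<1}" "g 0 = g a"
    and mono: "\<And>s t. -1 < s \<Longrightarrow> s \<le> t \<Longrightarrow> t < 1 \<Longrightarrow> g s \<le> g t"
    and t: "t \<in> closed_segment 0 a"
  shows "g t = g 0"
  using mono[of 0 t] mono[of t a] mono[of a t] mono[of t 0] assms(1,2) t
  by (auto simp: closed_segment_eq_real_ivl split: if_splits)

lemma connected_slit_domain: "connected \<E>"
proof (rule starlike_imp_connected)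
  have "closed_segment 0 z \<subseteq> \<E>" if z: "z \<in> \<E>" for z
  proof
    fix w assume "w \<in> closed_segment 0 z"
    then obtain u where u: "0 \<le> u" "u \<le> 1" "w = u *\<^sub>R z"
      by (auto simp: in_segment)
    show "w \<in> \<E>"
    proof (cases "Im w = 0")
      case True
      \<comment> \<open>A real \<open>w\<close> comes from \<open>u = 0\<close> or from a real
        \<open>z\<close>, for which shrinking towards 0 stays inside the interval.\<close>
      have "u * \<bar>Re z\<bar> \<le> \<bar>Re z\<bar>" using u by (simp add: mult_left_le_one_le)
      with True u z show ?thesis
        by (auto simp: mem_slit_domain_iff abs_mult)
    qed (simp add: mem_slit_domain_iff)
  qed
  then show "starlike \<E>"
    unfolding starlike_def by (intro bexI[of _ 0]) (auto simp: mem_slit_domain_iff)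
qed

text \<open>Scalar form of the theorem. Invariance enters as \<open>inv\<close>, its instance at 0,
  because the Moebius map sends 0 to \<open>a\<close>.\<close>

lemma nevanlinna_fixed_point_const:
  assumes hol: "f holomorphic_on \<E>"
    and real: "\<And>t. t \<in> {-1<..<1} \<Longrightarrow> Im (f (of_real t)) = 0"
    and nonneg: "\<And>z. Im z \<noteq> 0 \<Longrightarrow> 0 \<le> Im z * Im (f z)"
    and a: "a \<in> {-1<..<1}" "a \<noteq> 0"
    and inv: "f (of_real a) = f 0"
    and z: "z \<in> \<E>"
  shows "f z = f 0"
proof -
  have inE: "of_real t \<in> \<E>" if "t \<in> {-1<..<1}" for t :: real
    using that by (auto simp: mem_slit_domain_iff)
  have f': "(f has_field_derivative deriv f (of_real t)) (at (of_real t))" if "t \<in> {-1<..<1}" for t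
    using hol inE[OF that] open_slit_domain by (intro holomorphic_derivI)
  define g where "g = (\<lambda>t::real. Re (f (of_real t)))"
  have g': "(g has_real_derivative Re (deriv f (of_real t))) (at t)" if "t \<in> {-1<..<1}" for t
  proof -
    have "(of_real has_vector_derivative 1) (at t)"
      by (auto simp: has_vector_derivative_def scaleR_conv_of_real intro!: derivative_eq_intros)
    then have "((f \<circ> of_real) has_vector_derivative 1 * deriv f (of_real t)) (at t)"
      using f'[OF that] by (rule field_vector_diff_chain_at)
    from bounded_linear.has_vector_derivative[OF bounded_linear_Re this] show ?thesis
      by (simp add: g_def o_def has_real_derivative_iff_has_vector_derivative)
  qed
  have mono: "g s \<le> g t" if "-1 < s" "s \<le> t" "t < 1" for s t
  proof (rule DERIV_nonneg_imp_nondecreasing[OF that(2)])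
    fix u assume "s \<le> u" "u \<le> t"
    with that have u: "u \<in> {-1<..<1}" by auto
    show "\<exists>y. (g has_real_derivative y) (at u) \<and> 0 \<le> y"
      using g'[OF u] nevanlinna_deriv_nonneg[OF f'[OF u] real[OF u] nonneg] by blast
  qed
  have seg: "closed_segment 0 a \<subseteq> {-1<..<1}"
    using a by (auto simp: closed_segment_eq_real_ivl split: if_splits)
  have const: "f (of_real t) = f 0" if "t \<in> closed_segment 0 a" for t
  proof (rule complex_eqI)
    show "Re (f (of_real t)) = Re (f 0)"
      using nondecreasing_eq_between[of a g, OF a(1) _ mono that] inv by (simp add: g_def)
    show "Im (f (of_real t)) = Im (f 0)"
      using real[of t] real[of 0] that seg by auto
  qed
  have "f z - f 0 = 0"
  proof (rule analytic_continuation[where U = "of_real ` closed_segment 0 a" and \<xi> = 0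
        and f = "\<lambda>z. f z - f 0" and S = \<E>])
    \<comment> \<open>As \<open>a \<noteq> 0\<close>, the segment is connected with more than one
      point, so each of its points, in particular 0, is a limit point.\<close>
    have "(0::complex) islimpt closed_segment 0 (of_real a)"
      using a by (intro connected_imp_perfect) (auto, metis ends_in_segment of_real_eq_0_iff singletonD)
    also have "closed_segment 0 (of_real a) = (of_real ` closed_segment 0 a :: complex set)"
      using closed_segment_of_real[of 0 a, where 'a = complex] by simp
    finally show "(0::complex) islimpt of_real ` closed_segment 0 a" .
  qed (use z hol seg const inE[of 0] open_slit_domain connected_slit_domain
        in \<open>auto intro!: holomorphic_intros inE\<close>)
  then show ?thesis by simp
qed

text \<open>The map taking \<open>T\<close> to \<open>cinner (T x) y\<close> is bounded and respects
  complex scalars, so it carries convergent operator difference quotients to convergent scalar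
  ones.\<close>

lemma op_holomorphic_cinner:
  fixes F :: "complex \<Rightarrow> 'a::complex_hilbert \<Rightarrow>\<^sub>L 'a"
  assumes "F op_holomorphic_on S"
  shows "(\<lambda>z. cinner (F z x) y) holomorphic_on S"
  unfolding holomorphic_on_def field_differentiable_def has_field_derivative_iff
proof
  fix z assume "z \<in> S"
  then obtain D where D: "((\<lambda>w. scaleC_op (1 / (w - z)) (F w - F z)) \<longlongrightarrow> D) (at z within S)"
    using assms unfolding op_holomorphic_on_def by blast
  have "bounded_linear (\<lambda>T :: 'a \<Rightarrow>\<^sub>L 'a. cinner (T x) y)"
  proof (rule bounded_linear_intro[where K = "norm x * norm y"])
    fix T :: "'a \<Rightarrow>\<^sub>L 'a"
    have "norm (cinner (T x) y) \<le> norm (T x) * norm y" by (rule cinner_Cauchy_Schwarz)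
    also have "\<dots> \<le> norm T * norm x * norm y" by (intro mult_right_mono norm_blinfun) auto
    finally show "norm (cinner (T x) y) \<le> norm T * (norm x * norm y)" by (simp add: mult.assoc)
  qed (auto simp: blinfun.add_left blinfun.scaleR_left cinner_simps scaleR_conv_of_real)
  from bounded_linear.tendsto[OF this D]
  show "\<exists>D. ((\<lambda>w. (cinner (F w x) y - cinner (F z x) y) / (w - z)) \<longlongrightarrow> D) (at z within S)"
    by (auto simp: scaleC_op.rep_eq cinner_simps blinfun.diff_left)
qed

text \<open>The form of the adjoint is the complex conjugate. This turns the operator inequality for
  \<open>Im_op\<close> into a sign condition on a scalar function.\<close>

lemma cinner_Im_op:
  assumes "T \<in> bounded_ops"
  shows "cinner (Im_op T x) x = of_real (Im (cinner (T x) x))"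
proof -
  have "cinner (cadjoint T x) x = cnj (cinner (T x) x)"
    by (subst cinner_commute) (simp add: cadjoint[OF assms])
  then show ?thesis
    by (simp add: Im_op_def scaleC_op.rep_eq cinner_simps blinfun.diff_left complex_eq_iff)
qed

text \<open>Polarization: the forms at \<open>x + y\<close> determine the sum of the two cross
  terms, and replacing \<open>y\<close> by \<open>\<i> *\<^sub>C y\<close> determines their
  difference.\<close>

lemma bounded_ops_eqI:
  assumes "S \<in> bounded_ops" "T \<in> bounded_ops" and eq: "\<And>x. cinner (S x) x = cinner (T x) x"
  shows "S = T"
proof (rule blinfun_eqI)
  fix x
  have 1: "cinner (S x) y + cinner (S y) x = cinner (T x) y + cinner (T y) x" for x y
    using eq[of "x + y"] eq[of x] eq[of y] by (simp add: blinfun.add_right cinner_simps algebra_simps)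
  have "cinner (S x) y = cinner (T x) y" for y
  proof -
    \<comment> \<open>The second slot of \<open>cinner\<close> releases the conjugate of \<i>, while
      complex linearity of \<open>S\<close> and \<open>T\<close> releases \<i> itself.\<close>
    have "- \<i> * cinner (S x) y + \<i> * cinner (S y) x = - \<i> * cinner (T x) y + \<i> * cinner (T y) x"
      using 1[of x "\<i> *\<^sub>C y"] assms(1,2) by (simp add: bounded_ops_def cinner_simps)
    then have "\<i> * (cinner (S y) x - cinner (S x) y) = \<i> * (cinner (T y) x - cinner (T x) y)"
      by (simp add: algebra_simps)
    then have "cinner (S y) x - cinner (S x) y = cinner (T y) x - cinner (T x) y"
      by simp
    moreover note 1[of x y]
    ultimately show ?thesis by (simp add: complex_eq_iff)
  qed
  then have "cinner y (S x) = cinner y (T x)" for y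
    using cinner_commute[of y "S x"] cinner_commute[of y "T x"] by simp
  then show "S x = T x" by (rule cinner_ext)
qed

theorem proposition6p13:
  fixes a :: real and \<Omega> :: "complex \<Rightarrow> 'a::complex_hilbert \<Rightarrow>\<^sub>L 'a"
  assumes "separable_space (euclidean :: 'a topology)"
    and "a \<in> {-1<..<1}" and "a \<noteq> 0"
    and "\<Omega> \<in> moebius_fixed_points a"
  shows "\<Omega> constant_on \<E>"
proof -
  have RS: "\<Omega> \<in> RS" and inv: "\<And>z. z \<in> \<E> \<Longrightarrow> \<Omega> (moebius a z) = \<Omega> z"
    using assms(4) by (auto simp: moebius_fixed_points_def moebius_map_def)
  have E: "\<And>z. z \<in> \<E> \<Longrightarrow> \<Omega> z \<in> bounded_ops" and hol: "\<Omega> op_holomorphic_on \<E>"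
    and le: "\<And>t::real. t \<in> {-1<..<1} \<Longrightarrow> \<Omega> (of_real t) \<le>\<^sub>o\<^sub>p id_blinfun"
    and nonneg: "\<And>z. Im z \<noteq> 0 \<Longrightarrow> 0 \<le>\<^sub>o\<^sub>p Im z *\<^sub>R Im_op (\<Omega> z)"
    using RS by (auto simp: RS_def nevanlinna_def complex_is_Real_iff)
  have 0: "0 \<in> \<E>" by (simp add: mem_slit_domain_iff)
  have "\<Omega> z = \<Omega> 0" if z: "z \<in> \<E>" for z
  proof (rule bounded_ops_eqI[OF E[OF z] E[OF 0]])
    fix x
    show "cinner (\<Omega> z x) x = cinner (\<Omega> 0 x) x"
    proof (rule nevanlinna_fixed_point_const[OF op_holomorphic_cinner[OF hol] _ _ assms(2,3) _ z])
      \<comment> \<open>\<open>op_le\<close> makes the form of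
        \<open>id_blinfun - \<Omega> t\<close> real, and the form of the identity is the real number
        \<open>(norm x)\<^sup>2\<close>.\<close>
      show "Im (cinner (\<Omega> (of_real t) x) x) = 0" if "t \<in> {-1<..<1}" for t
        using le[OF that] by (auto simp: op_le_def blinfun.diff_left cinner_diff_left cinner_self
            complex_nonneg_Reals_iff simp flip: of_real_power)
      show "0 \<le> Im w * Im (cinner (\<Omega> w x) x)" if "Im w \<noteq> 0" for w
      proof -
        have "w \<in> \<E>" using that by (simp add: mem_slit_domain_iff)
        then show ?thesis
          using nonneg[OF that] by (simp add: op_le_def blinfun.scaleR_left cinner_scaleR_left
              cinner_Im_op E complex_nonneg_Reals_iff)
      qed
      show "cinner (\<Omega> (of_real a) x) x = cinner (\<Omega> 0 x) x"
        using inv[OF 0] by (simp add: moebius_def)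
    qed
  qed
  then show ?thesis by (auto simp: constant_on_def)
qed

end
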